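(* Let $A\in\mathbb{H}^{m\times n}$ have full column rank, let $p\ge2$ be an integer, $\alpha\in(0,2/\|A\|_2^2)$, $X_0=\alpha A^H$, and $X_{k+1}=\sum_{i=0}^{p-1}F_k^{\,i}X_k$ where $F_k=I_n-X_kA$. Then $\|F_k\|_2\le\|F_0\|_2^{\,p^k}\to0$, hence $X_kA\to I_n$; moreover $AX_k\to P=AA^\dagger$; and $(X_k)$ converges in operator norm to $A^\dagger$.
   Context: $\mathbb{H}$ denotes the real quaternions; $X^H=\overline{X}^\top$ is the quaternionic conjugate transpose; $\|\cdot\|_2$ is the operator norm induced by the Euclidean norm $\|x\|_2=\sqrt{\mathrm{Re}\,x^Hx}$. $A^\dagger$ is the Moore–Penrose pseudoinverse: the unique $A^\dagger\in\mathbb{H}^{n\times m}$ with $AA^\dagger A=A$, $A^\dagger AA^\dagger=A^\dagger$, $(AA^\dagger)^H=AA^\dagger$, $(A^\dagger A)^H=A^\dagger A$. All products are quaternionic matrix products in the written order. *)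

theory Defs
  imports "HOL-Analysis.Analysis"
begin

section \<open>Real quaternions\<close>

datatype quat = Quat (qre: real) (qi: real) (qj: real) (qk: real)

lemma quat_eqI: "qre a = qre b \<Longrightarrow> qi a = qi b \<Longrightarrow> qj a = qj b \<Longrightarrow> qk a = qk b \<Longrightarrow> a = b"
  by (cases a; cases b) auto

instantiation quat :: ring_1
begin
definition "0 = Quat 0 0 0 0"
definition "1 = Quat 1 0 0 0"
definition "a + b = Quat (qre a + qre b) (qi a + qi b) (qj a + qj b) (qk a + qk b)"
definition "a - b = Quat (qre a - qre b) (qi a - qi b) (qj a - qj b) (qk a - qk b)"
definition "- a = Quat (- qre a) (- qi a) (- qj a) (- qk a)"
definition "a * b = Quat
   (qre a * qre b - qi a * qi b - qj a * qj b - qk a * qk b)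
   (qre a * qi b + qi a * qre b + qj a * qk b - qk a * qj b)
   (qre a * qj b - qi a * qk b + qj a * qre b + qk a * qi b)
   (qre a * qk b + qi a * qj b - qj a * qi b + qk a * qre b)"
instance
  by standard (auto intro!: quat_eqI simp: zero_quat_def one_quat_def plus_quat_def
      minus_quat_def uminus_quat_def times_quat_def algebra_simps)
end

text \<open>Quaternionic conjugate and the embedding of the reals.\<close>
definition qcnj :: "quat \<Rightarrow> quat" where
  "qcnj a = Quat (qre a) (- qi a) (- qj a) (- qk a)"

definition qof_real :: "real \<Rightarrow> quat" where
  "qof_real r = Quat r 0 0 0"

text \<open>Squared modulus of a quaternion (= real part of conj(a) * a).\<close>
definition qnorm2 :: "quat \<Rightarrow> real" where
  "qnorm2 a = (qre a)^2 + (qi a)^2 + (qj a)^2 + (qk a)^2"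

section \<open>Quaternion matrices (m x n matrix = quat^'n^'m)\<close>

text \<open>Conjugate transpose X^H.\<close>
definition qadj :: "quat^'n^'m \<Rightarrow> quat^'m^'n" where
  "qadj A = (\<chi> i j. qcnj (A $ j $ i))"

text \<open>Euclidean norm of a quaternion vector: sqrt (Re x^H x).\<close>
definition qvnorm :: "quat^'n \<Rightarrow> real" where
  "qvnorm x = sqrt (\<Sum>i\<in>UNIV. qnorm2 (x $ i))"

text \<open>Induced operator 2-norm.\<close>
definition qopnorm :: "quat^'n^'m \<Rightarrow> real" where
  "qopnorm A = Sup {qvnorm (A *v x) | x. qvnorm x \<le> 1}"

text \<open>Scalar multiple of a matrix by a real number.\<close>
definition qscale :: "real \<Rightarrow> quat^'n^'m \<Rightarrow> quat^'n^'m" where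
  "qscale r A = (\<chi> i j. qof_real r * A $ i $ j)"

text \<open>Matrix powers.\<close>
definition qmpow :: "quat^'n^'n \<Rightarrow> nat \<Rightarrow> quat^'n^'n" where
  "qmpow M k = ((\<lambda>Y. M ** Y) ^^ k) (mat 1)"

text \<open>Full column rank: the columns are (right-)linearly independent.\<close>
definition full_col_rank :: "quat^'n^'m \<Rightarrow> bool" where
  "full_col_rank A \<longleftrightarrow> (\<forall>x. A *v x = 0 \<longrightarrow> x = 0)"

text \<open>Moore--Penrose conditions and the pseudoinverse.\<close>
definition is_pinv :: "quat^'n^'m \<Rightarrow> quat^'m^'n \<Rightarrow> bool" where
  "is_pinv A G \<longleftrightarrow> A ** G ** A = A \<and> G ** A ** G = G \<and>
     qadj (A ** G) = A ** G \<and> qadj (G ** A) = G ** A"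

definition qpinv :: "quat^'n^'m \<Rightarrow> quat^'m^'n" where
  "qpinv A = (THE G. is_pinv A G)"

end

theory Submission
  imports Defs
begin

text \<open>
  The residual \<open>F\<^sub>k = I - X\<^sub>k A\<close> of the hyperpower iteration satisfies
  \<open>F\<^sub>k\<^sub>+\<^sub>1 = F\<^sub>k\<^sup>p\<close> (a telescoping geometric sum), so
  \<open>\<parallel>F\<^sub>k\<parallel> \<le> \<parallel>F\<^sub>0\<parallel>\<^bsup>p\<^sup>k\<^esup>\<close>. Since \<open>A\<close> has full column rank it is bounded below,
  \<open>\<parallel>x\<parallel> \<le> g \<parallel>Ax\<parallel>\<close>, and expanding
  \<open>\<parallel>(I - \<alpha> A\<^sup>H A) x\<parallel>\<^sup>2 \<le> \<parallel>x\<parallel>\<^sup>2 - \<alpha> (2 - \<alpha> \<parallel>A\<parallel>\<^sup>2) \<parallel>Ax\<parallel>\<^sup>2\<close> gives \<open>\<parallel>F\<^sub>0\<parallel> < 1\<close>.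
  Every iterate has the form \<open>Y A\<^sup>H\<close>, hence \<open>X\<^sub>k A A\<^sup>\<dagger> = X\<^sub>k\<close>, and so
  \<open>X\<^sub>k - A\<^sup>\<dagger> = (X\<^sub>k A - I) A\<^sup>\<dagger>\<close> converges to \<open>0\<close> at the same rate.
\<close>

section \<open>Quaternions as a Euclidean space\<close>

lemma quat_sel_simps [simp]:
  "qre 0 = 0" "qi 0 = 0" "qj 0 = 0" "qk 0 = 0"
  "qre 1 = 1" "qi 1 = 0" "qj 1 = 0" "qk 1 = 0"
  "qre (a + b) = qre a + qre b" "qi (a + b) = qi a + qi b"
  "qj (a + b) = qj a + qj b" "qk (a + b) = qk a + qk b"
  "qre (a - b) = qre a - qre b" "qi (a - b) = qi a - qi b"
  "qj (a - b) = qj a - qj b" "qk (a - b) = qk a - qk b"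
  "qre (- a) = - qre a" "qi (- a) = - qi a" "qj (- a) = - qj a" "qk (- a) = - qk a"
  "qre (a * b) = qre a * qre b - qi a * qi b - qj a * qj b - qk a * qk b"
  "qi (a * b) = qre a * qi b + qi a * qre b + qj a * qk b - qk a * qj b"
  "qj (a * b) = qre a * qj b - qi a * qk b + qj a * qre b + qk a * qi b"
  "qk (a * b) = qre a * qk b + qi a * qj b - qj a * qi b + qk a * qre b"
  by (simp_all add: zero_quat_def one_quat_def plus_quat_def minus_quat_def
      uminus_quat_def times_quat_def)

instantiation quat :: real_vector
begin
definition "scaleR r a = Quat (r * qre a) (r * qi a) (r * qj a) (r * qk a)"
instance by standard (auto intro!: quat_eqI simp: scaleR_quat_def algebra_simps)
end

lemma quat_scaleR_sel [simp]:
  "qre (r *\<^sub>R a) = r * qre a" "qi (r *\<^sub>R a) = r * qi a"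
  "qj (r *\<^sub>R a) = r * qj a" "qk (r *\<^sub>R a) = r * qk a"
  by (simp_all add: scaleR_quat_def)

instance quat :: real_algebra_1
  by standard (auto intro!: quat_eqI simp: algebra_simps)

instantiation quat :: real_inner
begin
definition "inner a b = qre a * qre b + qi a * qi b + qj a * qj b + qk a * qk b"
definition "norm (a::quat) = sqrt (inner a a)"
definition "sgn (a::quat) = a /\<^sub>R norm a"
definition "dist (a::quat) b = norm (a - b)"
definition "uniformity = (INF e\<in>{0 <..}. principal {(x, y::quat). dist x y < e})"
definition "open (U :: quat set) \<longleftrightarrow> (\<forall>x\<in>U. eventually (\<lambda>(x', y). x' = x \<longrightarrow> y \<in> U) uniformity)"
instance proof
  fix a b c :: quat and r :: real
  show "inner a b = inner b a" "inner (a + b) c = inner a c + inner b c"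
    "inner (r *\<^sub>R a) b = r * inner a b" "0 \<le> inner a a"
    by (simp_all add: inner_quat_def algebra_simps)
  show "inner a a = 0 \<longleftrightarrow> a = 0"
  proof
    assume "inner a a = 0"
    then have "(qre a)\<^sup>2 + (qi a)\<^sup>2 + (qj a)\<^sup>2 + (qk a)\<^sup>2 = 0"
      by (simp add: inner_quat_def power2_eq_square)
    then show "a = 0"
      by (intro quat_eqI) (simp_all add: sum_power2_eq_zero_iff add_nonneg_eq_0_iff)
  qed (simp add: inner_quat_def)
qed (rule norm_quat_def sgn_quat_def dist_quat_def uniformity_quat_def open_quat_def)+
end

text \<open>Finite dimension over \<open>\<real>\<close> is what makes an injective square quaternion matrix
  surjective, and hence invertible.\<close>

instantiation quat :: euclidean_space
begin
definition "Basis = {Quat 1 0 0 0, Quat 0 1 0 0, Quat 0 0 1 0, Quat 0 0 0 (1::real)}"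
instance proof
  fix u v x :: quat
  show "u \<in> Basis \<Longrightarrow> v \<in> Basis \<Longrightarrow> inner u v = (if u = v then 1 else 0)"
    unfolding Basis_quat_def by (elim insertE emptyE; simp add: inner_quat_def)
  show "(\<forall>u\<in>Basis. inner x u = 0) \<longleftrightarrow> x = 0"
    by (auto intro: quat_eqI simp: Basis_quat_def inner_quat_def)
qed (simp_all add: Basis_quat_def)
end

lemma qvnorm_eq_norm: "qvnorm x = norm x"
proof -
  have "(norm a)\<^sup>2 = qnorm2 a" for a :: quat
    by (simp add: norm_quat_def inner_quat_def qnorm2_def power2_eq_square)
  then show ?thesis
    by (simp add: qvnorm_def norm_vec_def L2_set_def)
qed

lemma qcnj_sel [simp]:
  "qre (qcnj a) = qre a" "qi (qcnj a) = - qi a" "qj (qcnj a) = - qj a" "qk (qcnj a) = - qk a"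
  by (simp_all add: qcnj_def)

lemma qcnj_qcnj [simp]: "qcnj (qcnj a) = a"
  and qcnj_0 [simp]: "qcnj 0 = 0"
  and qcnj_1 [simp]: "qcnj 1 = 1"
  and qcnj_add: "qcnj (a + b) = qcnj a + qcnj b"
  and qcnj_mult: "qcnj (a * b) = qcnj b * qcnj a"
  by (rule quat_eqI; simp add: algebra_simps)+

lemma qcnj_sum: "qcnj (sum f S) = (\<Sum>x\<in>S. qcnj (f x))"
  by (induction S rule: infinite_finite_induct) (simp_all add: qcnj_add)

lemma inner_qcnj_mult: "inner a (qcnj c * b) = inner (c * a) (b::quat)"
  by (simp add: inner_quat_def algebra_simps)

lemma qof_real_mult: "qof_real r * a = r *\<^sub>R a"
  by (rule quat_eqI) (simp_all add: qof_real_def)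

lemma qscale_eq_scaleR: "qscale r M = r *\<^sub>R M"
  by (simp add: qscale_def vec_eq_iff qof_real_mult)

section \<open>Matrix algebra\<close>

lemma matrix_add_rdistrib: "((A::'a::semiring_1^'n^'m) + B) ** C = A ** C + B ** C"
  by (vector matrix_matrix_mult_def sum.distrib distrib_right)

lemma matrix_diff_ldistrib: "(A::'a::ring_1^'n^'m) ** (B - C) = A ** B - A ** C"
  by (vector matrix_matrix_mult_def sum_subtractf right_diff_distrib)

lemma matrix_diff_rdistrib: "((A::'a::ring_1^'n^'m) - B) ** C = A ** C - B ** C"
  by (vector matrix_matrix_mult_def sum_subtractf left_diff_distrib)

lemma scaleR_matrix_vector_assoc: "(r *\<^sub>R (M::'a::real_algebra_1^'n^'m)) *v x = r *\<^sub>R (M *v x)"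
  by (simp add: vec_eq_iff matrix_vector_mult_def scaleR_sum_right)

lemma matrix_vector_mult_axis: "((M::'a::semiring_1^'n^'m) *v axis j 1) $ i = M $ i $ j"
  by (simp add: matrix_vector_mult_def axis_def if_distrib cong: if_cong)

lemma matrix_eq_columns:
  "(\<And>j. (M::'a::semiring_1^'n^'m) *v axis j 1 = N *v axis j 1) \<Longrightarrow> M = N"
  by (metis matrix_vector_mult_axis vec_eq_iff)

lemma qmpow_0 [simp]: "qmpow M 0 = mat 1"
  by (simp add: qmpow_def)

lemma qmpow_Suc: "qmpow M (Suc i) = M ** qmpow M i"
  by (simp add: qmpow_def)

lemma qmpow_Suc': "qmpow M (Suc i) = qmpow M i ** M"
  by (induction i) (simp_all add: qmpow_Suc matrix_mul_assoc)

lemma qmpow_geometric_sum: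
  "(\<Sum>i<p. qmpow (F::quat^'n^'n) i) ** (mat 1 - F) = mat 1 - qmpow F p"
proof (induction p)
  case (Suc p)
  have "(\<Sum>i<Suc p. qmpow F i) ** (mat 1 - F)
      = (\<Sum>i<p. qmpow F i) ** (mat 1 - F) + qmpow F p ** (mat 1 - F)"
    by (simp add: matrix_add_rdistrib)
  also have "\<dots> = (mat 1 - qmpow F p) + (qmpow F p - qmpow F p ** F)"
    by (subst Suc.IH) (simp only: matrix_diff_ldistrib[of "qmpow F p"] matrix_mul_rid)
  finally show ?case
    by (simp add: qmpow_Suc')
qed (simp flip: zero_vec_def)

section \<open>Adjoint and operator norm\<close>

lemma qadj_nth [simp]: "qadj M $ i $ j = qcnj (M $ j $ i)"
  by (simp add: qadj_def)

lemma qadj_qadj [simp]: "qadj (qadj M) = M"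
  by (simp add: vec_eq_iff)

lemma qadj_mat1 [simp]: "qadj (mat 1) = mat 1"
  by (simp add: vec_eq_iff mat_def)

lemma qadj_mult: "qadj ((M::quat^'n^'m) ** (N::quat^'p^'n)) = qadj N ** qadj M"
  by (simp add: vec_eq_iff matrix_matrix_mult_def qcnj_sum qcnj_mult)

lemma inner_qadj: "inner x (qadj (M::quat^'n^'m) *v y) = inner (M *v x) y"
proof -
  have "inner x (qadj M *v y) = (\<Sum>j\<in>UNIV. \<Sum>i\<in>UNIV. inner (M$i$j * x$j) (y$i))"
    by (simp add: inner_vec_def matrix_vector_mult_def inner_sum_right inner_qcnj_mult)
  also have "\<dots> = inner (M *v x) y"
    by (subst sum.swap) (simp add: inner_vec_def matrix_vector_mult_def inner_sum_left)
  finally show ?thesis .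
qed

lemma qopnorm_eq_onorm: "qopnorm (M::quat^'n^'m) = onorm ((*v) M)"
proof -
  define S where "S = {norm (M *v x) | x. norm x \<le> 1}"
  have bounded: "y \<le> onorm ((*v) M)" if "y \<in> S" for y
  proof -
    obtain x where "y = norm (M *v x)" "norm x \<le> 1"
      using \<open>y \<in> S\<close> by (auto simp: S_def)
    then show ?thesis
      using onorm[of "(*v) M" x] onorm_pos_le[of "(*v) M"]
      by (simp add: order_trans mult_left_le)
  qed
  have "S \<noteq> {}"
    by (auto simp: S_def intro!: exI[of _ 0])
  then have "qopnorm M \<le> onorm ((*v) M)"
    by (simp add: qopnorm_def qvnorm_eq_norm cSup_least bounded flip: S_def)
  moreover have "onorm ((*v) M) \<le> qopnorm M"
  proof (rule onorm_le)
    fix x :: "quat^'n"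
    show "norm (M *v x) \<le> qopnorm M * norm x"
    proof (cases "x = 0")
      case False
      have "norm (M *v (x /\<^sub>R norm x)) \<in> S"
        using False by (auto simp: S_def)
      then have "norm (M *v (x /\<^sub>R norm x)) \<le> qopnorm M"
        using bounded by (auto simp: qopnorm_def qvnorm_eq_norm intro!: cSup_upper bdd_aboveI
            simp flip: S_def)
      then show ?thesis
        using False by (simp add: linear_scale[OF bounded_linear.linear] field_simps)
    qed simp
  qed
  ultimately show ?thesis
    by simp
qed

lemma qopnorm_nonneg: "0 \<le> qopnorm (M::quat^'n^'m)"
  by (simp add: qopnorm_eq_onorm onorm_pos_le)

lemma norm_matrix_vector_le: "norm ((M::quat^'n^'m) *v x) \<le> qopnorm M * norm x"
  by (simp add: qopnorm_eq_onorm onorm)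

lemma qopnorm_le: "(\<And>x. norm ((M::quat^'n^'m) *v x) \<le> K * norm x) \<Longrightarrow> qopnorm M \<le> K"
  by (simp add: qopnorm_eq_onorm onorm_le)

lemma qopnorm_mult_le:
  "qopnorm ((M::quat^'n^'m) ** (N::quat^'p^'n)) \<le> qopnorm M * qopnorm N"
proof -
  have "(*v) (M ** N) = (*v) M \<circ> (*v) N"
    by (simp add: fun_eq_iff matrix_vector_mul_assoc)
  then show ?thesis
    by (simp add: qopnorm_eq_onorm onorm_compose)
qed

lemma qopnorm_minus_commute: "qopnorm ((M::quat^'n^'m) - N) = qopnorm (N - M)"
proof -
  have "(*v) (M - N) = (\<lambda>x. - ((N - M) *v x))"
    by (simp add: fun_eq_iff matrix_vector_mult_diff_rdistrib)
  then show ?thesis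
    by (simp add: qopnorm_eq_onorm onorm_neg)
qed

lemma qopnorm_qmpow_le: "qopnorm (qmpow (M::quat^'n^'n) i) \<le> qopnorm M ^ i"
proof (induction i)
  case 0
  have "(*v) (mat 1 :: quat^'n^'n) = (\<lambda>x. x)"
    by (simp add: fun_eq_iff)
  then show ?case
    using onorm_id_le by (simp add: qopnorm_eq_onorm)
next
  case (Suc i)
  then show ?case
    using qopnorm_mult_le[of M "qmpow M i"]
    by (simp add: qmpow_Suc order_trans mult_left_mono qopnorm_nonneg)
qed

lemma qopnorm_qadj_le: "qopnorm (qadj (M::quat^'n^'m)) \<le> qopnorm M"
proof (rule qopnorm_le)
  fix y
  define z where "z = qadj M *v y"
  have "norm z * norm z = inner z z"
    by (simp flip: power2_eq_square power2_norm_eq_inner)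
  also have "\<dots> = inner (M *v z) y"
    by (simp add: z_def inner_qadj)
  also have "\<dots> \<le> norm (M *v z) * norm y"
    by (rule Cauchy_Schwarz_ineq2[THEN abs_le_D1])
  also have "\<dots> \<le> qopnorm M * norm z * norm y"
    by (rule mult_right_mono[OF norm_matrix_vector_le norm_ge_zero])
  finally show "norm z \<le> qopnorm M * norm y"
    by (cases "z = 0") (auto simp: mult.commute mult.left_commute qopnorm_nonneg)
qed

lemma qopnorm_qadj: "qopnorm (qadj (M::quat^'n^'m)) = qopnorm M"
  by (metis antisym qadj_qadj qopnorm_qadj_le)

section \<open>Matrices of full column rank\<close>

lemma is_pinv_unique:
  fixes A :: "quat^'n^'m"
  assumes G: "is_pinv A G" and H: "is_pinv A H"
  shows "G = H"
proof -
  from G have G1: "A ** G ** A = A" and G2: "G ** A ** G = G"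
    and G3: "qadj (A ** G) = A ** G" and G4: "qadj (G ** A) = G ** A"
    by (auto simp: is_pinv_def)
  from H have H1: "A ** H ** A = A" and H2: "H ** A ** H = H"
    and H3: "qadj (A ** H) = A ** H" and H4: "qadj (H ** A) = H ** A"
    by (auto simp: is_pinv_def)
  have "qadj A = qadj ((A ** H) ** A)" using H1 by simp
  also have "\<dots> = qadj A ** qadj (A ** H)" by (rule qadj_mult)
  also have "\<dots> = qadj A ** (A ** H)" using H3 by simp
  finally have AH: "qadj A = qadj A ** (A ** H)" .
  have "qadj A = qadj (A ** (G ** A))" using G1 by (simp add: matrix_mul_assoc)
  also have "\<dots> = qadj (G ** A) ** qadj A" by (rule qadj_mult)
  also have "\<dots> = G ** A ** qadj A" using G4 by simp
  finally have AG: "qadj A = G ** A ** qadj A" .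
  have "G = G ** (A ** G)" using G2 by (simp add: matrix_mul_assoc)
  also have "\<dots> = G ** (qadj G ** qadj A)" using G3 by (simp add: qadj_mult)
  also have "\<dots> = G ** (qadj G ** (qadj A ** (A ** H)))" using AH by simp
  also have "\<dots> = G ** (qadj (A ** G)) ** A ** H" by (simp add: qadj_mult matrix_mul_assoc)
  also have "\<dots> = G ** A ** H" using G2 G3 by (simp add: matrix_mul_assoc)
  finally have GAH: "G = G ** A ** H" .
  have "H = (H ** A) ** H" using H2 by simp
  also have "\<dots> = qadj A ** qadj H ** H" using H4 by (simp add: qadj_mult)
  also have "\<dots> = (G ** A ** qadj A) ** qadj H ** H" using AG by simp
  also have "\<dots> = G ** A ** (qadj (H ** A)) ** H" by (simp add: qadj_mult matrix_mul_assoc)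
  also have "\<dots> = (G ** A) ** (H ** A ** H)" using H4 by (simp add: matrix_mul_assoc)
  also have "\<dots> = G ** A ** H" using H2 by simp
  finally show ?thesis using GAH by simp
qed

lemma qpinv_eqI: "is_pinv (A::quat^'n^'m) G \<Longrightarrow> qpinv A = G"
  unfolding qpinv_def by (rule the_equality) (auto intro: is_pinv_unique)

lemma is_pinv_range:
  assumes "is_pinv (A::quat^'n^'m) G"
  shows "qadj A ** (A ** G) = qadj A"
proof -
  from assms have G1: "A ** G ** A = A" and G3: "qadj (A ** G) = A ** G"
    by (simp_all add: is_pinv_def)
  have "qadj A ** (A ** G) = qadj A ** qadj (A ** G)"
    by (simp only: G3)
  also have "\<dots> = qadj (A ** G ** A)"
    by (simp only: qadj_mult)
  also have "\<dots> = qadj A"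
    by (simp only: G1)
  finally show ?thesis .
qed

lemma injective_matrix_invertible:
  fixes B :: "quat^'n^'n"
  assumes inj: "\<And>x. B *v x = 0 \<Longrightarrow> x = 0"
  obtains C where "B ** C = mat 1" and "C ** B = mat 1"
proof -
  have inj_B: "B *v x = B *v y \<Longrightarrow> x = y" for x y
    using inj[of "x - y"] by (simp add: matrix_vector_mult_diff_distrib)
  then have "inj ((*v) B)"
    by (rule injI)
  then have "surj ((*v) B)"
    by (simp add: linear_injective_imp_surjective bounded_linear.linear)
  define v where "v j = inv ((*v) B) (axis j 1)" for j
  have v: "B *v v j = axis j 1" for j
    using \<open>surj ((*v) B)\<close> by (simp add: v_def surj_f_inv_f)
  define C where "C = (\<chi> i j. v j $ i)"
  have BC: "B ** C = mat 1"
  proof (rule matrix_eq_columns)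
    fix j
    have "C *v axis j 1 = v j"
      by (simp add: vec_eq_iff matrix_vector_mult_axis C_def)
    then show "(B ** C) *v axis j 1 = mat 1 *v axis j 1"
      by (simp add: v flip: matrix_vector_mul_assoc)
  qed
  have "C ** B = mat 1"
    unfolding matrix_eq
  proof
    fix x
    have "B *v ((C ** B) *v x) = B *v x"
      by (simp add: matrix_vector_mul_assoc matrix_mul_assoc BC)
    then show "(C ** B) *v x = mat 1 *v x"
      by (simp add: inj_B)
  qed
  with BC that show ?thesis
    by blast
qed

lemma full_col_rank_gram_injective:
  fixes A :: "quat^'n^'m"
  assumes "full_col_rank A" and "(qadj A ** A) *v x = 0"
  shows "x = 0"
proof -
  have "inner (A *v x) (A *v x) = inner x ((qadj A ** A) *v x)"
    by (simp add: inner_qadj flip: matrix_vector_mul_assoc)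
  with assms show ?thesis
    by (simp add: full_col_rank_def)
qed

lemma full_col_rank_pinv:
  fixes A :: "quat^'n^'m"
  assumes rank: "full_col_rank A"
  shows "is_pinv A (qpinv A)" and "qpinv A ** A = mat 1"
proof -
  obtain C where BC: "(qadj A ** A) ** C = mat 1" and CB: "C ** (qadj A ** A) = mat 1"
    using injective_matrix_invertible[OF full_col_rank_gram_injective[OF rank]] by blast
  have "qadj C ** (qadj A ** A) = mat 1"
    using arg_cong[OF BC, of qadj] by (simp add: qadj_mult matrix_mul_assoc)
  then have C_herm: "qadj C = C"
    using BC matrix_mul_assoc[of "qadj C" "qadj A ** A" C] by simp
  define G where "G = C ** qadj A"
  have GA: "G ** A = mat 1"
    using CB by (simp add: G_def matrix_mul_assoc)
  have "qadj (A ** G) = A ** G"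
    by (simp add: G_def qadj_mult C_herm matrix_mul_assoc)
  then have "is_pinv A G"
    by (simp add: is_pinv_def GA flip: matrix_mul_assoc)
  with GA show "is_pinv A (qpinv A)" and "qpinv A ** A = mat 1"
    by (simp_all add: qpinv_eqI)
qed

lemma full_col_rank_bounded_below:
  fixes A :: "quat^'n^'m"
  assumes "full_col_rank A"
  obtains g where "0 < g" and "\<And>x. norm x \<le> g * norm (A *v x)"
proof
  fix x
  have "norm x = norm (qpinv A *v (A *v x))"
    by (simp add: matrix_vector_mul_assoc full_col_rank_pinv assms)
  also have "\<dots> \<le> qopnorm (qpinv A) * norm (A *v x)"
    by (rule norm_matrix_vector_le)
  also have "\<dots> \<le> (qopnorm (qpinv A) + 1) * norm (A *v x)"
    by (simp add: distrib_right)
  finally show "norm x \<le> (qopnorm (qpinv A) + 1) * norm (A *v x)" .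
qed (simp add: qopnorm_nonneg add_nonneg_pos)

lemma qopnorm_id_minus_scaled_gram_lt_1:
  fixes A :: "quat^'n^'m"
  assumes rank: "full_col_rank A" and alpha_pos: "0 < \<alpha>" and alpha_lt: "\<alpha> < 2 / (qopnorm A)\<^sup>2"
  shows "qopnorm (mat 1 - \<alpha> *\<^sub>R (qadj A ** A)) < 1"
proof -
  obtain g where g_pos: "0 < g" and below: "\<And>x. norm x \<le> g * norm (A *v x)"
    using full_col_rank_bounded_below[OF rank] by blast
  have "\<alpha> * (qopnorm A)\<^sup>2 < 2"
    \<comment> \<open>if \<open>qopnorm A = 0\<close>, the hypothesis reads \<open>\<alpha> < 2 / 0 = 0\<close>\<close>
    using alpha_pos alpha_lt by (cases "qopnorm A = 0") (simp_all add: pos_less_divide_eq)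
  define c where "c = \<alpha> * (2 - \<alpha> * (qopnorm A)\<^sup>2)"
  have c_pos: "0 < c"
    using \<open>\<alpha> * (qopnorm A)\<^sup>2 < 2\<close> alpha_pos by (simp add: c_def)
  define s where "s = 1 - c / g\<^sup>2"
  have contract: "(norm ((mat 1 - \<alpha> *\<^sub>R (qadj A ** A)) *v x))\<^sup>2 \<le> s * (norm x)\<^sup>2" for x
  proof -
    define y where "y = A *v x"
    define z where "z = qadj A *v y"
    have xz: "inner x z = (norm y)\<^sup>2"
      by (simp add: z_def inner_qadj y_def power2_norm_eq_inner)
    have "\<alpha> * norm z \<le> \<alpha> * (qopnorm A * norm y)"
      using norm_matrix_vector_le[of "qadj A" y] alpha_pos by (simp add: z_def qopnorm_qadj)
    then have z_le: "\<alpha>\<^sup>2 * (norm z)\<^sup>2 \<le> \<alpha>\<^sup>2 * ((qopnorm A)\<^sup>2 * (norm y)\<^sup>2)"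
      using alpha_pos by (simp add: power_mono flip: power_mult_distrib)
    have "(norm x)\<^sup>2 \<le> (g * norm y)\<^sup>2"
      using below[of x] by (simp add: y_def power_mono)
    then have x_le: "(norm x)\<^sup>2 / g\<^sup>2 \<le> (norm y)\<^sup>2"
      using g_pos by (simp add: divide_le_eq power_mult_distrib mult.commute)
    have "(norm ((mat 1 - \<alpha> *\<^sub>R (qadj A ** A)) *v x))\<^sup>2 = (norm (x - \<alpha> *\<^sub>R z))\<^sup>2"
      by (simp add: y_def z_def matrix_vector_mult_diff_rdistrib scaleR_matrix_vector_assoc
          matrix_vector_mul_assoc)
    also have "\<dots> = inner (x - \<alpha> *\<^sub>R z) (x - \<alpha> *\<^sub>R z)"
      by (rule power2_norm_eq_inner)
    also have "\<dots> = inner x x - 2 * \<alpha> * inner x z + \<alpha>\<^sup>2 * inner z z"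
      by (simp add: inner_diff_left inner_diff_right inner_commute[of z x] power2_eq_square
          algebra_simps)
    also have "\<dots> = (norm x)\<^sup>2 - 2 * \<alpha> * inner x z + \<alpha>\<^sup>2 * (norm z)\<^sup>2"
      by (simp add: power2_norm_eq_inner)
    also have "\<dots> \<le> (norm x)\<^sup>2 - c * (norm y)\<^sup>2"
      using z_le by (simp add: xz c_def algebra_simps power2_eq_square)
    also have "\<dots> \<le> s * (norm x)\<^sup>2"
      using mult_left_mono[OF x_le, of c] c_pos by (simp add: s_def algebra_simps)
    finally show ?thesis .
  qed
  have "qopnorm (mat 1 - \<alpha> *\<^sub>R (qadj A ** A)) \<le> sqrt (max 0 s)"
  proof (rule qopnorm_le)
    fix x
    have "(norm ((mat 1 - \<alpha> *\<^sub>R (qadj A ** A)) *v x))\<^sup>2 \<le> max 0 s * (norm x)\<^sup>2"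
      using contract[of x] mult_right_mono[of s "max 0 s" "(norm x)\<^sup>2"] by simp
    then have "norm ((mat 1 - \<alpha> *\<^sub>R (qadj A ** A)) *v x) \<le> sqrt (max 0 s * (norm x)\<^sup>2)"
      by (rule real_le_rsqrt)
    then show "norm ((mat 1 - \<alpha> *\<^sub>R (qadj A ** A)) *v x) \<le> sqrt (max 0 s) * norm x"
      by (simp add: real_sqrt_mult)
  qed
  moreover have "sqrt (max 0 s) < 1"
    using c_pos g_pos by (simp add: s_def)
  ultimately show ?thesis
    by linarith
qed

section \<open>The hyperpower iteration\<close>

lemma hyperpower_residual:
  fixes A :: "quat^'n^'m" and X :: "quat^'m^'n" and p :: nat
  shows "mat 1 - ((\<Sum>i<p. qmpow (mat 1 - X ** A) i) ** X) ** A = qmpow (mat 1 - X ** A) p"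
  using qmpow_geometric_sum[of "mat 1 - X ** A" p] by (simp add: matrix_mul_assoc)

lemma hyperpower_residual_le:
  fixes A :: "quat^'n^'m" and X :: "nat \<Rightarrow> quat^'m^'n"
  assumes step: "\<forall>k. X (Suc k) = (\<Sum>i<p. qmpow (mat 1 - X k ** A) i) ** X k"
  shows "qopnorm (mat 1 - X k ** A) \<le> qopnorm (mat 1 - X 0 ** A) ^ p ^ k"
proof (induction k)
  case (Suc k)
  have "qopnorm (mat 1 - X (Suc k) ** A) \<le> qopnorm (mat 1 - X k ** A) ^ p"
    using qopnorm_qmpow_le by (simp add: step hyperpower_residual)
  also have "\<dots> \<le> (qopnorm (mat 1 - X 0 ** A) ^ p ^ k) ^ p"
    using Suc.IH by (simp add: power_mono qopnorm_nonneg)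
  finally show ?case
    by (simp add: power_mult[symmetric] mult.commute)
qed simp

lemma hyperpower_error:
  fixes A :: "quat^'n^'m" and X :: "nat \<Rightarrow> quat^'m^'n"
  assumes pinv: "is_pinv A G"
    and start: "X 0 = \<alpha> *\<^sub>R qadj A"
    and step: "\<forall>k. X (Suc k) = (\<Sum>i<p. qmpow (mat 1 - X k ** A) i) ** X k"
  shows "X k - G = (X k ** A - mat 1) ** G"
proof -
  have "X k ** (A ** G) = X k"
    by (induction k) (simp_all add: start step is_pinv_range[OF pinv]
        flip: matrix_mul_assoc scalar_matrix_assoc)
  then show ?thesis
    by (simp add: matrix_diff_rdistrib matrix_mul_assoc)
qed

lemma power_power_tendsto_0:
  fixes q :: real and p :: nat
  assumes "0 \<le> q" and "q < 1" and "2 \<le> p"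
  shows "(\<lambda>k. q ^ p ^ k) \<longlonglongrightarrow> 0"
proof (rule Lim_null_comparison[OF always_eventually LIMSEQ_power_zero])
  show "\<forall>k. norm (q ^ p ^ k) \<le> q ^ k"
  proof
    fix k
    have "k \<le> 2 ^ k"
      by (simp add: less_imp_le)
    also have "\<dots> \<le> p ^ k"
      using \<open>2 \<le> p\<close> by (simp add: power_mono)
    finally show "norm (q ^ p ^ k) \<le> q ^ k"
      using assms by (simp add: power_decreasing)
  qed
qed (use assms in simp)

lemma qopnorm_tendsto_0_by_bound:
  fixes M :: "nat \<Rightarrow> quat^'n^'m"
  assumes "\<And>k. qopnorm (M k) \<le> c * r k" and "r \<longlonglongrightarrow> 0"
  shows "(\<lambda>k. qopnorm (M k)) \<longlonglongrightarrow> 0"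
  by (rule Lim_null_comparison[OF always_eventually tendsto_mult_right_zero[OF assms(2), of c]])
    (simp add: qopnorm_nonneg assms(1))

theorem mainTheorem6:
  fixes A :: "quat^'n::finite^'m::finite"
    and X :: "nat \<Rightarrow> quat^'m^'n"
    and p :: nat and \<alpha> :: real
  assumes rank: "full_col_rank A"
    and p: "p \<ge> 2"
    and alpha_pos: "0 < \<alpha>" and alpha_lt: "\<alpha> < 2 / (qopnorm A)^2"
    and X0: "X 0 = qscale \<alpha> (qadj A)"
    and XSuc: "\<forall>k. X (Suc k) = (\<Sum>i<p. qmpow (mat 1 - X k ** A) i) ** X k"
  shows "(\<forall>k. qopnorm (mat 1 - X k ** A) \<le> qopnorm (mat 1 - X 0 ** A) ^ (p ^ k))
    \<and> ((\<lambda>k. qopnorm (mat 1 - X 0 ** A) ^ (p ^ k)) \<longlonglongrightarrow> 0)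
    \<and> ((\<lambda>k. qopnorm (X k ** A - mat 1)) \<longlonglongrightarrow> 0)
    \<and> ((\<lambda>k. qopnorm (A ** X k - A ** qpinv A)) \<longlonglongrightarrow> 0)
    \<and> ((\<lambda>k. qopnorm (X k - qpinv A)) \<longlonglongrightarrow> 0)"
proof -
  define q where "q = qopnorm (mat 1 - X 0 ** A)"
  define G where "G = qpinv A"
  have "q < 1"
    using qopnorm_id_minus_scaled_gram_lt_1[OF rank alpha_pos alpha_lt]
    by (simp add: q_def X0 qscale_eq_scaleR scalar_matrix_assoc)
  then have rate: "(\<lambda>k. q ^ p ^ k) \<longlonglongrightarrow> 0"
    using p by (simp add: power_power_tendsto_0 q_def qopnorm_nonneg)
  have residual: "qopnorm (X k ** A - mat 1) \<le> 1 * q ^ p ^ k" for k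
    using hyperpower_residual_le[OF XSuc] by (simp add: q_def qopnorm_minus_commute)
  have error: "qopnorm (X k - G) \<le> qopnorm G * q ^ p ^ k" for k
    using qopnorm_mult_le[of "X k ** A - mat 1" G] residual[of k]
      hyperpower_error[OF full_col_rank_pinv(1)[OF rank] X0[unfolded qscale_eq_scaleR] XSuc]
    by (simp add: mult.commute mult_left_mono qopnorm_nonneg order_trans G_def)
  have range_error: "qopnorm (A ** X k - A ** G) \<le> (qopnorm A * qopnorm G) * q ^ p ^ k" for k
    using qopnorm_mult_le[of A "X k - G"] error[of k]
    by (simp add: matrix_diff_ldistrib mult.assoc mult_left_mono qopnorm_nonneg order_trans)
  show ?thesis
    using hyperpower_residual_le[OF XSuc] rate
      qopnorm_tendsto_0_by_bound[OF residual rate] qopnorm_tendsto_0_by_bound[OF error rate]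
      qopnorm_tendsto_0_by_bound[OF range_error rate]
    by (simp add: q_def G_def)
qed

end
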